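(* $$\limsup_{n \rightarrow \infty} \frac{\iota_{\rm c}(n)}{n} = \frac{1}{4}.$$
   Context: All graphs are finite and simple. For a graph $G$ and $v \in V(G)$, $N[v]$ is the set consisting of $v$ and its neighbours; for $D \subseteq V(G)$, $N[D] = \bigcup_{v \in D} N[v]$, and $G - N[D]$ is the subgraph of $G$ induced by $V(G) \setminus N[D]$. A set $D \subseteq V(G)$ is a cycle isolating set of $G$ if $G - N[D]$ contains no cycle (of any length $\geq 3$). $\iota_{\rm c}(G)$ denotes the size of a smallest cycle isolating set of $G$. For an integer $n \geq 1$, $\iota_{\rm c}(n)$ denotes the maximum of $\iota_{\rm c}(G)$ over all connected graphs $G$ with $V(G) = \{1,\dots,n\}$ and $G \not\simeq K_3$. *)

theory Defs
  imports Complex_Main "HOL-Library.Extended_Real"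
begin

type_synonym 'a graph = "'a set \<times> 'a set set"

abbreviation verts :: "'a graph \<Rightarrow> 'a set" where
  "verts G \<equiv> fst G"

abbreviation edges :: "'a graph \<Rightarrow> 'a set set" where
  "edges G \<equiv> snd G"

definition simple_graph :: "'a graph \<Rightarrow> bool" where
  "simple_graph G \<longleftrightarrow> finite (verts G) \<and>
     edges G \<subseteq> {{u, v} | u v. u \<in> verts G \<and> v \<in> verts G \<and> u \<noteq> v}"

definition adj :: "'a graph \<Rightarrow> 'a \<Rightarrow> 'a \<Rightarrow> bool" where
  "adj G u v \<longleftrightarrow> {u, v} \<in> edges G"

definition closed_nbhd :: "'a graph \<Rightarrow> 'a \<Rightarrow> 'a set" where
  "closed_nbhd G v = insert v {u \<in> verts G. adj G v u}"

definition closed_nbhd_set :: "'a graph \<Rightarrow> 'a set \<Rightarrow> 'a set" where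
  "closed_nbhd_set G D = (\<Union>v\<in>D. closed_nbhd G v)"

definition induced_subgraph :: "'a graph \<Rightarrow> 'a set \<Rightarrow> 'a graph" where
  "induced_subgraph G W = (W, {e \<in> edges G. e \<subseteq> W})"

text \<open>A cycle of length \<open>k \<ge> 3\<close> is given by the list of its \<open>k\<close> distinct vertices in cyclic order.\<close>

definition is_cycle :: "'a graph \<Rightarrow> 'a list \<Rightarrow> bool" where
  "is_cycle G xs \<longleftrightarrow> length xs \<ge> 3 \<and> distinct xs \<and> set xs \<subseteq> verts G \<and>
     (\<forall>i < length xs. adj G (xs ! i) (xs ! (Suc i mod length xs)))"

definition connected_graph :: "'a graph \<Rightarrow> bool" where
  "connected_graph G \<longleftrightarrow> verts G \<noteq> {} \<and>
     (\<forall>u \<in> verts G. \<forall>v \<in> verts G. (adj G)\<^sup>*\<^sup>* u v)"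

definition graph_iso :: "'a graph \<Rightarrow> 'b graph \<Rightarrow> bool" where
  "graph_iso G H \<longleftrightarrow> (\<exists>f. bij_betw f (verts G) (verts H) \<and>
     (\<forall>u \<in> verts G. \<forall>v \<in> verts G. adj G u v \<longleftrightarrow> adj H (f u) (f v)))"

definition complete_graph :: "nat \<Rightarrow> nat graph" where
  "complete_graph n = ({1..n}, {{u, v} | u v. u \<in> {1..n} \<and> v \<in> {1..n} \<and> u \<noteq> v})"

definition cycle_isolating :: "'a graph \<Rightarrow> 'a set \<Rightarrow> bool" where
  "cycle_isolating G D \<longleftrightarrow> D \<subseteq> verts G \<and>
     \<not> (\<exists>xs. is_cycle (induced_subgraph G (verts G - closed_nbhd_set G D)) xs)"

definition cycle_isolation_number :: "'a graph \<Rightarrow> nat" where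
  "cycle_isolation_number G = Min {card D | D. cycle_isolating G D}"

text \<open>For \<open>n = 0\<close> the set below is empty and the value of \<open>Max\<close> is unspecified.\<close>

definition max_cycle_isolation_number :: "nat \<Rightarrow> nat" where
  "max_cycle_isolation_number n =
     Max {cycle_isolation_number G | G. simple_graph G \<and> verts G = {1..n} \<and>
            connected_graph G \<and> \<not> graph_iso G (complete_graph 3)}"

end

(*
  Upper bound: every connected graph G on n vertices other than the triangle has a cycle isolating
  set of size at most n/4, by induction on n. If the maximum degree is at most 2, one vertex
  suffices. Otherwise let v have maximum degree and consider the components of G - N[v]. If none is
  a triangle, v together with isolating sets of the components works. If some neighbour x of v is
  adjacent to two triangle components, take v, x and, for each triangle component not adjacent to
  x, one neighbour of v adjacent to it. Otherwise pick a triangle component H, a neighbour x of v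
  adjacent to some y in H, and delete the four vertices of {x} \<union> H, a subset of N[y]. The only
  component of the rest that can be a triangle contains v; then the degree of v is 3 and a
  local analysis of the two triangles and x finishes.

  Lower bound: attach a clique of size 4 at every vertex of a connected graph. Each clique needs
  its own vertex of an isolating set.
*)

theory Submission
  imports Defs
begin

section \<open>Vertex sets of a fixed adjacency relation: domination, cores, components\<close>

locale sym_irrefl_rel =
  fixes E :: "'a \<Rightarrow> 'a \<Rightarrow> bool"
  assumes E_sym: "E u v \<Longrightarrow> E v u"
    and E_irrefl: "\<not> E u u"
begin

definition dominated :: "'a set \<Rightarrow> 'a set" where
  "dominated D = D \<union> {w. \<exists>d\<in>D. E d w}"

text \<open>A core induces a subgraph of minimum degree at least 2. Working with cores instead of cycles
  suffices, since the vertex set of a cycle is a core.\<close>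

definition core :: "'a set \<Rightarrow> bool" where
  "core T \<longleftrightarrow> (\<forall>t\<in>T. \<exists>u\<in>T. \<exists>w\<in>T. u \<noteq> w \<and> E t u \<and> E t w)"

text \<open>For finite \<open>S\<close> this means that \<open>S\<close> induces a forest. The empty
  set is exempt because it is vacuously a core.\<close>

definition core_free :: "'a set \<Rightarrow> bool" where
  "core_free S \<longleftrightarrow> (\<forall>T\<subseteq>S. core T \<longrightarrow> T = {})"

definition separated :: "'a set \<Rightarrow> 'a set \<Rightarrow> bool" where
  "separated A B \<longleftrightarrow> (\<forall>a\<in>A. \<forall>b\<in>B. \<not> E a b)"

text \<open>Connectedness is expressed by cuts instead of paths, so that it directly yields an edge
  leaving a proper part. The empty set counts as connected.\<close>

definition conn :: "'a set \<Rightarrow> bool" where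
  "conn S \<longleftrightarrow> (\<forall>C. C \<subseteq> S \<and> C \<noteq> {} \<and> separated C (S - C) \<longrightarrow> C = S)"

definition component :: "'a set \<Rightarrow> 'a set \<Rightarrow> bool" where
  "component C S \<longleftrightarrow> C \<subseteq> S \<and> C \<noteq> {} \<and> conn C \<and> separated C (S - C)"

definition triangle :: "'a set \<Rightarrow> bool" where
  "triangle S \<longleftrightarrow> card S = 3 \<and> (\<forall>u\<in>S. \<forall>w\<in>S. u \<noteq> w \<longrightarrow> E u w)"

definition quarter_isolable :: "'a set \<Rightarrow> bool" where
  "quarter_isolable S \<longleftrightarrow> (\<exists>D\<subseteq>S. core_free (S - dominated D) \<and> 4 * card D \<le> card S)"

lemma E_neq: "E u v \<Longrightarrow> u \<noteq> v"
  using E_irrefl by blast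

text \<open>With no edge between the two parts of \<open>T\<close>, both neighbours that the core
  property gives to a vertex of \<open>T \<inter> A\<close> stay in \<open>A\<close>.\<close>

lemma core_Int:
  assumes "core T" "separated (T \<inter> A) (T - A)"
  shows "core (T \<inter> A)"
  using assms unfolding core_def separated_def by blast

lemma core_freeD: "core_free S \<Longrightarrow> T \<subseteq> S \<Longrightarrow> core T \<Longrightarrow> T = {}"
  by (simp add: core_free_def)

lemma dominated_Un: "dominated (A \<union> B) = dominated A \<union> dominated B"
  by (auto simp: dominated_def)

lemma separated_sym: "separated A B \<Longrightarrow> separated B A"
  using E_sym by (auto simp: separated_def)

lemma separated_mono: "separated A B \<Longrightarrow> A' \<subseteq> A \<Longrightarrow> B' \<subseteq> B \<Longrightarrow> separated A' B'"
  by (auto simp: separated_def)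

lemma connE:
  assumes "conn S" "C \<subseteq> S" "C \<noteq> {}" "C \<noteq> S"
  obtains c d where "c \<in> C" "d \<in> S - C" "E c d"
proof -
  have "\<not> separated C (S - C)" using assms by (auto simp: conn_def)
  thus ?thesis using that by (auto simp: separated_def)
qed

section \<open>Assembling isolating sets from pieces\<close>

text \<open>Only the undominated part of \<open>A\<close> has to be cut off from the rest. A core
  avoiding \<open>dominated (D0 \<union> D)\<close> then splits: its part in \<open>A\<close> is a
  core, hence empty, and what lies in \<open>S - A\<close> is handled by \<open>D\<close>.\<close>

lemma quarter_isolable_extend:
  assumes fin: "finite S" and A: "A \<subseteq> S" and D0: "D0 \<subseteq> S" "4 * card D0 \<le> card A"
    and rest: "quarter_isolable (S - A)"
    and free: "core_free (A - dominated D0)"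
    and sep: "separated (A - dominated D0) (S - A)"
  shows "quarter_isolable S"
proof -
  obtain D where D: "D \<subseteq> S - A" "core_free ((S - A) - dominated D)" "4 * card D \<le> card (S - A)"
    using rest by (auto simp: quarter_isolable_def)
  have "T = {}" if T: "T \<subseteq> S - dominated (D0 \<union> D)" "core T" for T
  proof -
    have s: "separated (T \<inter> A) (T - A)"
      by (rule separated_mono[OF sep]) (use T in \<open>auto simp: dominated_Un\<close>)
    have "core (T \<inter> A)"
      using core_Int[OF T(2) s] .
    hence 1: "T \<inter> A = {}"
      using core_freeD[OF free, of "T \<inter> A"] T by (auto simp: dominated_Un)
    have "T \<subseteq> (S - A) - dominated D"
      using T 1 by (auto simp: dominated_Un)
    thus ?thesis using core_freeD[OF D(2)] T(2) by blast
  qed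
  moreover have "4 * card (D0 \<union> D) \<le> card S"
  proof -
    have "card (D0 \<union> D) \<le> card D0 + card D" by (rule card_Un_le)
    moreover have "card S = card A + card (S - A)"
      using fin A by (metis card_Diff_subset card_mono finite_subset le_add_diff_inverse)
    ultimately show ?thesis using D0 D by linarith
  qed
  ultimately show ?thesis
    unfolding quarter_isolable_def core_free_def using D0 D
    by (intro exI[of _ "D0 \<union> D"]) auto
qed

lemma quarter_isolable_extend_dominated:
  assumes fin: "finite S" and A: "A \<subseteq> S" "A \<subseteq> dominated {d}" "4 \<le> card A" and d: "d \<in> S"
    and rest: "quarter_isolable (S - A)"
  shows "quarter_isolable S"
proof (rule quarter_isolable_extend[OF fin A(1) _ _ rest])
  have empty: "A - dominated {d} = {}" using A(2) by blast
  show "core_free (A - dominated {d})" "separated (A - dominated {d}) (S - A)"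
    unfolding empty by (simp_all add: core_free_def separated_def)
qed (use d A(3) in auto)

text \<open>One component is split off at a time; components of what is left are still components of
  \<open>S\<close>.\<close>

lemma quarter_isolable_components:
  assumes "finite S" "\<And>C. component C S \<Longrightarrow> quarter_isolable C"
  shows "quarter_isolable S"
  using assms
proof (induction "card S" arbitrary: S rule: less_induct)
  case less
  show ?case
  proof (cases "S = {}")
    case True
    thus ?thesis by (auto simp: quarter_isolable_def core_free_def)
  next
    case False
    \<comment> \<open>A smallest nonempty set without edges to the rest of \<open>S\<close> is
      connected, since a cut of it would give a smaller such set.\<close>
    define P where "P C \<longleftrightarrow> C \<subseteq> S \<and> C \<noteq> {} \<and> separated C (S - C)" for C
    have "P S" using False by (auto simp: P_def separated_def)
    then obtain C where C: "P C" and min: "\<And>C'. P C' \<Longrightarrow> card C \<le> card C'"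
      using ex_has_least_nat[of P S card] by blast
    have fC: "finite C" using C less.prems finite_subset by (auto simp: P_def)
    have "conn C"
      unfolding conn_def
    proof (intro allI impI)
      fix C' assume C': "C' \<subseteq> C \<and> C' \<noteq> {} \<and> separated C' (C - C')"
      hence "P C'" using C unfolding P_def separated_def by blast
      thus "C' = C" using min C' fC by (meson card_seteq)
    qed
    hence cC: "component C S" using C by (auto simp: component_def P_def)
    have "quarter_isolable (S - C)"
    proof (rule less.hyps)
      show "card (S - C) < card S"
        using C less.prems(1) by (intro psubset_card_mono) (auto simp: P_def)
      fix C' assume "component C' (S - C)"
      hence "component C' S"
        using cC E_sym unfolding component_def separated_def by blast
      thus "quarter_isolable C'" by (rule less.prems(2))
    qed (use less.prems in auto)
    moreover obtain D where "D \<subseteq> C" "core_free (C - dominated D)" "4 * card D \<le> card C"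
      using less.prems(2)[OF cC] by (auto simp: quarter_isolable_def)
    moreover have "separated (C - dominated D) (S - C)"
      using cC by (auto simp: component_def separated_def)
    ultimately show ?thesis
      using quarter_isolable_extend[of S C D] cC less.prems(1) by (auto simp: component_def)
  qed
qed

section \<open>Maximum degree at most 2\<close>

text \<open>A nonempty core uses up both neighbours of each of its vertices, so no edge leaves it
  and by connectedness it is all of \<open>S\<close>. Any single vertex therefore destroys it, and
  excluding the triangle gives the four vertices that pay for that one.\<close>

lemma quarter_isolable_max_degree_2:
  assumes fin: "finite S" and con: "conn S" and tri: "\<not> triangle S"
    and deg: "\<And>u. u \<in> S \<Longrightarrow> card {w\<in>S. E u w} \<le> 2"
  shows "quarter_isolable S"
proof (cases "core_free S")
  case True
  thus ?thesis
    by (auto simp: quarter_isolable_def dominated_def intro!: exI[of _ "{}"])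
next
  case False
  have nbrs: "{z\<in>S. E t z} = {u, w}" if "t \<in> S" "u \<in> S" "w \<in> S" "u \<noteq> w" "E t u" "E t w" for t u w
    using card_seteq[of "{z\<in>S. E t z}" "{u,w}"] fin deg[OF that(1)] that by auto
  have whole: "T = S" if T: "T \<subseteq> S" "core T" "T \<noteq> {}" for T
  proof -
    have "separated T (S - T)"
      unfolding separated_def
    proof (intro ballI notI)
      fix t d assume td: "t \<in> T" "d \<in> S - T" "E t d"
      obtain u w where uw: "u \<in> T" "w \<in> T" "u \<noteq> w" "E t u" "E t w"
        using T(2) td(1) unfolding core_def by blast
      have "{z\<in>S. E t z} = {u, w}"
        by (rule nbrs) (use uw td T(1) in auto)
      moreover have "d \<in> {z\<in>S. E t z}" using td by blast
      ultimately show False using td(2) uw(1,2) by auto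
    qed
    thus ?thesis using con T unfolding conn_def by blast
  qed
  have S: "core S" "S \<noteq> {}" using False whole unfolding core_free_def by blast+
  then obtain s where s: "s \<in> S" by blast
  then obtain u w where uw: "u \<in> S" "w \<in> S" "u \<noteq> w" "E s u" "E s w"
    using S unfolding core_def by blast
  have c3: "card {s,u,w} = 3" using uw(3) E_neq[OF uw(4)] E_neq[OF uw(5)] by simp
  have "card S \<ge> 4"
  proof (rule ccontr)
    assume "\<not> 4 \<le> card S"
    hence Seq: "S = {s,u,w}"
      using card_seteq[of S "{s,u,w}"] fin c3 s uw by auto
    have "E u w"
      using S(1) unfolding core_def Seq using E_irrefl by blast
    hence "triangle S"
      using uw E_sym c3 unfolding triangle_def Seq by blast
    thus False using tri by simp
  qed
  moreover have "core_free (S - dominated {s})"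
    unfolding core_free_def using whole s by (auto simp: dominated_def)
  ultimately show ?thesis
    unfolding quarter_isolable_def using s by (intro exI[of _ "{s}"]) auto
qed

section \<open>Two triangles linked through one vertex, maximum degree 3\<close>

lemma nbrs_eq_3:
  assumes "finite S" "card {z\<in>S. E t z} \<le> 3"
    and "card {p,q,r} = 3" "{p,q,r} \<subseteq> S" "E t p" "E t q" "E t r"
  shows "{z\<in>S. E t z} = {p,q,r}"
proof (rule sym, rule card_seteq)
  show "card {z\<in>S. E t z} \<le> card {p,q,r}" using assms(2,3) by simp
qed (use assms(1,4-7) in auto)

text \<open>If the set \<open>{x}\<close> does not finish off both triangles, then the maximum degree 3 forces
  \<open>a\<close>, \<open>b\<close>, \<open>y2\<close>, \<open>y3\<close> to form a 4-cycle, and then \<open>{a}\<close> does.\<close>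

lemma quarter_isolable_two_triangles:
  assumes fin: "finite S" and S: "{v,a,b,x,y1,y2,y3} \<subseteq> S" "card {v,a,b,x,y1,y2,y3} = 7"
    and deg: "\<And>u. u \<in> S \<Longrightarrow> card {w\<in>S. E u w} \<le> 3"
    and E: "E v a" "E v b" "E v x" "E a b" "E x y1" "E y1 y2" "E y1 y3" "E y2 y3"
    and sep: "separated {v,a,b,y1,y2,y3} (S - {v,a,b,x,y1,y2,y3})"
    and rest: "quarter_isolable (S - {v,a,b,x,y1,y2,y3})"
  shows "quarter_isolable S"
proof (rule ccontr)
  assume bad: "\<not> quarter_isolable S"
  have dist: "distinct [v,a,b,x,y1,y2,y3]"
    by (rule card_distinct) (use S(2) in simp)
  define R where "R = S - {v,a,b,x,y1,y2,y3}"
  obtain D where D: "D \<subseteq> R" "core_free (R - dominated D)" "4 * card D \<le> card R"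
    using rest by (auto simp: quarter_isolable_def R_def)
  have cR: "card S = 7 + card R"
    unfolding R_def using S fin
    by (metis card_Diff_subset card_mono finite_subset le_add_diff_inverse)
  \<comment> \<open>The seven vertices pay for one vertex \<open>d\<close> besides \<open>D\<close>,
    so the assumed failure leaves a nonempty core for every choice of \<open>d\<close>. This is
    applied to \<open>x\<close> and then to \<open>a\<close>.\<close>
  have ex: "\<exists>T. T \<subseteq> S - dominated (insert d D) \<and> core T \<and> T \<noteq> {}" if "d \<in> S" for d
  proof -
    have "insert d D \<subseteq> S" using that D(1) by (auto simp: R_def)
    moreover have "4 * card (insert d D) \<le> card S"
      using cR D(3) card_insert_le_m1[of "Suc (card D)" D d] by (auto simp: card_insert_if finite_subset[OF D(1)])
    ultimately have "\<not> core_free (S - dominated (insert d D))"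
      using bad by (auto simp: quarter_isolable_def)
    thus ?thesis by (auto simp: core_free_def)
  qed
  have E': "E a v" "E b v" "E x v" "E b a" "E y1 x" "E y2 y1" "E y3 y1" "E y3 y2"
    using E E_sym by blast+
  have nb: "{z\<in>S. E t z} = {p,q,r}"
    if "t \<in> S" "distinct [p,q,r]" "{p,q,r} \<subseteq> S" "E t p" "E t q" "E t r" for t p q r
    using nbrs_eq_3[OF fin deg[OF that(1)], of p q r] that by auto
  obtain T where T: "T \<subseteq> S - dominated (insert x D)" "core T" "T \<noteq> {}"
    using ex[of x] S by auto
  have T2: "\<exists>u\<in>T. \<exists>w\<in>T. u \<noteq> w \<and> E t u \<and> E t w" if "t \<in> T" for t
    using T(2) that unfolding core_def by blast
  have notT: "v \<notin> T" "x \<notin> T" "y1 \<notin> T"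
    using T(1) E E' by (auto simp: dominated_def)
  have TS: "T \<subseteq> S" using T(1) by blast
  \<comment> \<open>Among the seven vertices only \<open>x\<close> may have neighbours in
    \<open>R\<close>, and \<open>x\<close> is not in \<open>T\<close>.\<close>
  have "core (T \<inter> R)"
  proof (rule core_Int[OF T(2)])
    show "separated (T \<inter> R) (T - R)"
      using separated_mono[OF separated_sym[OF sep], of "T \<inter> R" "T - R"] TS notT
      by (auto simp: R_def)
  qed
  moreover have "T \<inter> R \<subseteq> R - dominated D" using T(1) by (auto simp: dominated_def)
  ultimately have "T \<inter> R = {}" using core_freeD[OF D(2)] by blast
  hence T4: "T \<subseteq> {a,b,y2,y3}" using TS notT by (auto simp: R_def)
  \<comment> \<open>Besides \<open>v\<close> and \<open>b\<close>, the vertex \<open>a\<close> has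
    at most one neighbour, so of its two neighbours in \<open>T\<close> one is \<open>b\<close> and
    the other is \<open>y2\<close> or \<open>y3\<close>.\<close>
  have aT: "b \<in> T \<and> (\<exists>z\<in>{y2,y3}. z \<in> T \<and> E a z)" if t: "a \<in> T"
  proof -
    obtain u w where uw: "u \<in> T" "w \<in> T" "u \<noteq> w" "E a u" "E a w" using T2[OF t] by blast
    have u: "u \<in> {b,y2,y3}" "w \<in> {b,y2,y3}" using T4 uw E_irrefl by auto
    have "\<not> (u \<in> {y2,y3} \<and> w \<in> {y2,y3})"
      using nb[of a v u w] E' uw S(1) dist E by auto
    thus ?thesis using u uw by auto
  qed
  have bT: "a \<in> T \<and> (\<exists>z\<in>{y2,y3}. z \<in> T \<and> E b z)" if t: "b \<in> T"
  proof -
    obtain u w where uw: "u \<in> T" "w \<in> T" "u \<noteq> w" "E b u" "E b w" using T2[OF t] by blast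
    have u: "u \<in> {a,y2,y3}" "w \<in> {a,y2,y3}" using T4 uw E_irrefl by auto
    have "\<not> (u \<in> {y2,y3} \<and> w \<in> {y2,y3})"
      using nb[of b v u w] E' uw S(1) dist E by auto
    thus ?thesis using u uw by auto
  qed
  have ab: "a \<in> T"
  proof (rule ccontr)
    assume "a \<notin> T"
    hence "b \<notin> T" using bT by blast
    hence "T \<subseteq> {y2,y3}" using T4 \<open>a \<notin> T\<close> by blast
    thus False using T2 T(3) E_irrefl by blast
  qed
  then obtain z where z: "z \<in> {y2,y3}" "z \<in> T" "E a z" using aT by blast
  \<comment> \<open>The roles of \<open>y2\<close> and \<open>y3\<close> are symmetric:
    \<open>z\<close> is one adjacent to \<open>a\<close>, and \<open>z'\<close> is the
    other.\<close>
  define z' where "z' = (if z = y2 then y3 else y2)"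
  have z': "{z,z'} = {y2,y3}" "distinct [v,a,b,x,y1,z,z']" "{z,z'} \<subseteq> S"
    "E z z'" "E z' z" "E y1 z" "E y1 z'" "E z y1" "E z' y1" "E z a"
    using z(1,3) dist S(1) E E' E_sym unfolding z'_def by auto
  have inS: "v \<in> S" "a \<in> S" "b \<in> S" "x \<in> S" "y1 \<in> S" "z \<in> S" "z' \<in> S"
    using S(1) z'(3) by blast+
  have Nz: "{u\<in>S. E z u} = {y1,z',a}"
    by (rule nb) (use z' inS in auto)
  have "b \<in> T" using aT ab by blast
  then obtain t where t: "t \<in> {z,z'}" "t \<in> T" "E b t" using bT z'(1) by auto
  \<comment> \<open>\<open>z\<close> has no room for another neighbour, so \<open>b\<close> is
    joined to \<open>z'\<close>, and \<open>a\<close>, \<open>b\<close>, \<open>z'\<close>,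
    \<open>z\<close> form the 4-cycle.\<close>
  have "t \<noteq> z" using Nz t(3) inS z'(2) E_sym by auto
  hence bz: "E b z'" "z' \<in> T" using t by auto
  have Nz': "{u\<in>S. E z' u} = {y1,z,b}"
    by (rule nb) (use z' inS bz E_sym in auto)
  have Ny1: "{u\<in>S. E y1 u} = {x,z,z'}"
    by (rule nb) (use z' inS E' in auto)
  obtain U where U: "U \<subseteq> S - dominated (insert a D)" "core U" "U \<noteq> {}"
    using ex[of a] S by auto
  have US: "U \<subseteq> S" using U(1) by blast
  have U2: "\<exists>u\<in>U. \<exists>w\<in>U. u \<noteq> w \<and> E t u \<and> E t w" if "t \<in> U" for t
    using U(2) that unfolding core_def by blast
  have notU: "v \<notin> U" "a \<notin> U" "b \<notin> U" "z \<notin> U"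
    using U(1) E E' z by (auto simp: dominated_def)
  \<comment> \<open>Two of three neighbours outside \<open>U\<close> leave too few inside. As
    \<open>a\<close> dominates \<open>v\<close>, \<open>b\<close> and \<open>z\<close>, this peels
    off \<open>z'\<close> and then \<open>y1\<close>; after that the degree bound excludes
    \<open>x\<close>.\<close>
  have no: "t \<notin> U" if nt: "{u\<in>S. E t u} = {p,q,r}" "q \<notin> U" "r \<notin> U" for t p q r
  proof
    assume "t \<in> U"
    then obtain u w where uw: "u \<in> U" "w \<in> U" "u \<noteq> w" "E t u" "E t w" using U2 by blast
    hence "u \<in> {u\<in>S. E t u}" "w \<in> {u\<in>S. E t u}" using US by auto
    hence "u = p" "w = p" using uw(1,2) nt(2,3) unfolding nt(1) by auto
    thus False using uw(3) by simp
  qed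
  have 1: "z' \<notin> U" using no[OF Nz'] notU by simp
  have 2: "y1 \<notin> U" using no[OF Ny1] notU 1 by simp
  have 3: "x \<notin> U"
  proof
    assume "x \<in> U"
    then obtain u w where uw: "u \<in> U" "w \<in> U" "u \<noteq> w" "E x u" "E x w" using U2 by blast
    have "{z\<in>S. E x z} = {y1,u,w}"
      by (rule nb) (use uw US 2 inS E in auto)
    moreover have "v \<in> {z\<in>S. E x z}" using inS E' by auto
    ultimately show False using uw notU z'(2) by auto
  qed
  have "U \<subseteq> R"
    using US notU 1 2 3 z'(1) by (auto simp: R_def)
  hence "U \<subseteq> R - dominated D" using U(1) by (auto simp: dominated_def)
  thus False using core_freeD[OF D(2)] U by blast
qed

section \<open>Triangle components sharing a neighbour of \<open>v\<close>\<close>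

text \<open>The set \<open>{v,x} \<union> X\<close> is paid for as follows. Since \<open>x\<close>
  reaches two triangles, \<open>card X + 2 \<le> card K\<close>. The closed neighbourhood of
  \<open>v\<close> has at least \<open>2 + card X\<close> vertices and the triangles have at least
  \<open>3 * card X + 6\<close>, in total at least \<open>4 * (2 + card X)\<close>.\<close>

lemma quarter_isolable_shared_triangles:
  assumes fin: "finite S" and v: "v \<in> S"
  defines "P \<equiv> S - dominated {v}"
  defines "K \<equiv> {H. component H P \<and> triangle H}"
  assumes link: "\<And>H. H \<in> K \<Longrightarrow> \<exists>x\<in>S. E v x \<and> (\<exists>y\<in>H. E x y)"
    and x: "x \<in> S" "E v x" and H: "H1 \<in> K" "H2 \<in> K" "H1 \<noteq> H2"
      "\<exists>y\<in>H1. E x y" "\<exists>y\<in>H2. E x y"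
    and rest: "quarter_isolable (S - (dominated {v} \<inter> S \<union> \<Union>K))"
  shows "quarter_isolable S"
proof -
  \<comment> \<open>\<open>L\<close> collects the triangles that \<open>x\<close> does not reach;
    \<open>f\<close> picks for each triangle a neighbour of \<open>v\<close> adjacent to it.\<close>
  define L where "L = {H\<in>K. \<not> (\<exists>y\<in>H. E x y)}"
  obtain f where f: "\<And>H. H \<in> K \<Longrightarrow> f H \<in> S \<and> E v (f H) \<and> (\<exists>y\<in>H. E (f H) y)"
    using link by metis
  define X where "X = f ` L"
  define A where "A = dominated {v} \<inter> S \<union> \<Union>K"
  have KP: "H \<subseteq> P" if "H \<in> K" for H using that by (auto simp: K_def component_def)
  have PS: "P \<subseteq> S" "finite P" using fin by (auto simp: P_def)
  have finK: "finite K"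
    by (rule finite_subset[of _ "Pow P"]) (use KP PS in auto)
  have finX: "finite X" using finK by (auto simp: X_def L_def)
  have disj: "H \<inter> H' = {}" if "H \<in> K" "H' \<in> K" "H \<noteq> H'" for H H'
  proof (rule ccontr)
    assume ne: "H \<inter> H' \<noteq> {}"
    have H: "conn H" "conn H'" "separated H (P - H)" "separated H' (P - H')" "H \<subseteq> P" "H' \<subseteq> P"
      using that by (auto simp: K_def component_def)
    have "separated (H \<inter> H') (H - H \<inter> H')" "separated (H \<inter> H') (H' - H \<inter> H')"
      using H(3-6) unfolding separated_def by blast+
    hence "H \<inter> H' = H" "H \<inter> H' = H'" using H(1,2) ne unfolding conn_def by auto
    thus False using that by auto
  qed
  have nonadj: "separated H (P - H)" if "H \<in> K" for H using that by (auto simp: K_def component_def)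
  have "card (\<Union>K) = sum card K"
    by (rule card_Union_disjoint)
      (use disj finite_subset[OF KP PS(2)] in \<open>auto simp: pairwise_def disjnt_def\<close>)
  hence cU: "card (\<Union>K) = 3 * card K" by (simp add: K_def triangle_def)
  have "L \<union> {H1,H2} \<subseteq> K" "L \<inter> {H1,H2} = {}" using H by (auto simp: L_def)
  hence "card L + 2 \<le> card K"
    using card_mono[OF finK, of "L \<union> {H1,H2}"] card_Un_disjoint[of L "{H1,H2}"] finK H(3)
    by (auto simp: finite_subset L_def)
  moreover have "card X \<le> card L" unfolding X_def by (rule card_image_le) (use finK in \<open>auto simp: L_def\<close>)
  moreover have "2 + card X \<le> card (dominated {v} \<inter> S)"
  proof -
    have "insert v (insert x X) \<subseteq> dominated {v} \<inter> S"
      using v x f by (auto simp: X_def L_def dominated_def)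
    \<comment> \<open>Every vertex of \<open>X\<close> reaches a triangle of \<open>L\<close>, which
      \<open>x\<close> does not.\<close>
    moreover have "x \<notin> X" "v \<notin> insert x X"
      using x f E_irrefl by (auto simp: X_def L_def)
    ultimately show ?thesis
      using card_mono[of "dominated {v} \<inter> S" "insert v (insert x X)"] finX fin by auto
  qed
  moreover have "card A = card (dominated {v} \<inter> S) + card (\<Union>K)"
    unfolding A_def
    by (rule card_Un_disjoint)
      (use fin KP PS finite_subset[of "\<Union>K" P] in \<open>auto simp: P_def\<close>)
  moreover have "card ({v,x} \<union> X) \<le> 2 + card X"
    using card_Un_le[of "{v,x}" X] by (auto simp: card_insert_if split: if_splits)
  ultimately have card: "4 * card ({v,x} \<union> X) \<le> card A" using cU by linarith
  have sub: "A - dominated ({v,x} \<union> X) \<subseteq> \<Union>K"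
    by (auto simp: A_def dominated_def)
  show ?thesis
  proof (rule quarter_isolable_extend[OF fin, of A "{v,x} \<union> X"])
    show "A \<subseteq> S" using KP PS by (auto simp: A_def)
    show "{v,x} \<union> X \<subseteq> S" using v x f by (auto simp: X_def L_def)
    show "quarter_isolable (S - A)" using rest by (simp add: A_def)
    show "separated (A - dominated ({v,x} \<union> X)) (S - A)"
    proof -
      have "separated (\<Union>K) (S - A)"
        using nonadj by (auto simp: separated_def A_def P_def)
      thus ?thesis by (rule separated_mono) (use sub in auto)
    qed
    show "core_free (A - dominated ({v,x} \<union> X))"
      unfolding core_free_def
    proof (intro allI impI, rule ccontr)
      fix T assume T: "T \<subseteq> A - dominated ({v,x} \<union> X)" "core T" "T \<noteq> {}"
      \<comment> \<open>A vertex of \<open>H\<close> has no neighbours in \<open>P\<close> outside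
        \<open>H\<close>, so the two neighbours of \<open>t\<close> in \<open>T\<close> fill up
        \<open>H\<close>. But \<open>{v,x} \<union> X\<close> dominates a vertex of every
        triangle.\<close>
      then obtain t H where t: "t \<in> T" "t \<in> H" "H \<in> K" using sub by blast
      obtain u w where uw: "u \<in> T" "w \<in> T" "u \<noteq> w" "E t u" "E t w"
        using T(2) t(1) unfolding core_def by blast
      have "u \<in> P" "w \<in> P" using uw T sub KP by blast+
      hence "u \<in> H" "w \<in> H" using nonadj[OF t(3)] t uw by (auto simp: separated_def)
      moreover have "card {t,u,w} = 3"
        using uw(3) E_neq[OF uw(4)] E_neq[OF uw(5)] by simp
      moreover have "card H = 3" "finite H"
        using t(3) finite_subset[OF KP[OF t(3)] PS(2)] by (auto simp: K_def triangle_def)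
      ultimately have "H = {t,u,w}" using card_seteq[of H "{t,u,w}"] t by auto
      hence "H \<subseteq> T" using t uw by auto
      moreover have "\<exists>y\<in>H. \<exists>d\<in>{v,x} \<union> X. E d y"
        using f[OF t(3)] t(3) by (cases "H \<in> L") (auto simp: X_def L_def)
      ultimately show False using T(1) by (auto simp: dominated_def)
    qed
  qed (use card in auto)
qed

section \<open>The induction for connected vertex sets\<close>

theorem quarter_isolable_connected:
  assumes "finite S" "conn S" "S \<noteq> {}" "\<not> triangle S"
  shows "quarter_isolable S"
  using assms
proof (induction "card S" arbitrary: S rule: less_induct)
  case less
  note fin = less.prems(1) and con = less.prems(2)
  \<comment> \<open>\<open>R\<close> may be disconnected: the induction hypothesis is applied to its
    components, which are proper subsets of \<open>S\<close>.\<close>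
  have IH: "quarter_isolable R" if R: "R \<subset> S" "\<And>C. component C R \<Longrightarrow> \<not> triangle C" for R
  proof (rule quarter_isolable_components)
    show "finite R" using R fin finite_subset by blast
    fix C assume C: "component C R"
    hence "C \<subset> S" using R by (auto simp: component_def)
    thus "quarter_isolable C"
      using less.hyps[of C] C R(2) fin psubset_card_mono[of S C] finite_subset[of C S]
      by (auto simp: component_def)
  qed
  define N where "N u = {w\<in>S. E u w}" for u
  have "finite ((\<lambda>u. card (N u)) ` S)" "(\<lambda>u. card (N u)) ` S \<noteq> {}" using fin less.prems(3) by auto
  note max = Max_in[OF this] Max_ge[OF this(1)]
  obtain v where v: "v \<in> S" and vmax: "\<And>y. y \<in> S \<Longrightarrow> card (N y) \<le> card (N v)"
    using max by auto
  show ?case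
  proof (cases "card (N v) \<le> 2")
    case True
    show ?thesis
      by (rule quarter_isolable_max_degree_2) (use less.prems True vmax in \<open>auto simp: N_def intro: le_trans\<close>)
  next
    case False
    define P where "P = S - dominated {v}"
    define K where "K = {H. component H P \<and> triangle H}"
    have domv: "dominated {v} \<inter> S = insert v (N v)" using v by (auto simp: dominated_def N_def)
    have vN: "v \<notin> N v" using E_irrefl by (auto simp: N_def)
    have P: "P = S - insert v (N v)" by (auto simp: P_def domv[symmetric])
    \<comment> \<open>Connectedness gives an edge out of \<open>H\<close>. It cannot end in
      \<open>P\<close>, where \<open>H\<close> is a component, nor in \<open>v\<close>, since
      \<open>H\<close> misses \<open>N v\<close>.\<close>
    have link: "\<exists>x\<in>S. E v x \<and> (\<exists>y\<in>H. E x y)" if "H \<in> K" for H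
    proof -
      have H: "H \<subseteq> P" "H \<noteq> {}" "separated H (P - H)" using that by (auto simp: K_def component_def)
      hence "H \<subseteq> S" "H \<noteq> S" using v by (auto simp: P)
      then obtain h d where hd: "h \<in> H" "d \<in> S - H" "E h d"
        using connE[OF con _ H(2)] by blast
      hence "d \<in> insert v (N v)" using H(3) by (auto simp: separated_def P)
      moreover have "d \<noteq> v" using hd H(1) E_sym by (auto simp: P N_def)
      ultimately show ?thesis using hd E_sym by (auto simp: N_def)
    qed
    show ?thesis
    proof (cases "\<exists>x\<in>S. E v x \<and> (\<exists>H1\<in>K. \<exists>H2\<in>K. H1 \<noteq> H2 \<and> (\<exists>y\<in>H1. E x y) \<and> (\<exists>y\<in>H2. E x y))")
      case True
      then obtain x H1 H2 where x: "x \<in> S" "E v x" "H1 \<in> K" "H2 \<in> K" "H1 \<noteq> H2"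
        "\<exists>y\<in>H1. E x y" "\<exists>y\<in>H2. E x y" by blast
      have "quarter_isolable (S - (dominated {v} \<inter> S \<union> \<Union>K))"
      proof (rule IH)
        show "S - (dominated {v} \<inter> S \<union> \<Union>K) \<subset> S" using v by (auto simp: dominated_def)
        fix C assume C: "component C (S - (dominated {v} \<inter> S \<union> \<Union>K))"
        hence CP: "C \<subseteq> P" "\<And>H. H \<in> K \<Longrightarrow> C \<inter> H = {}" "C \<noteq> {}" "conn C"
          by (auto simp: component_def P_def)
        \<comment> \<open>No triangle in \<open>K\<close> has edges to the rest of \<open>P\<close>,
          so a component left after removing them all is already a component of \<open>P\<close>.
          Being disjoint from them, it is not a triangle.\<close>
        have "separated C (P - C)"
        proof -
          have "separated C H" if "H \<in> K" for H
          proof -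
            have "separated H (P - H)" using that by (simp add: K_def component_def)
            from separated_mono[OF separated_sym[OF this]] show ?thesis using CP(1) CP(2)[OF that] by blast
          qed
          moreover have "separated C (S - (dominated {v} \<inter> S \<union> \<Union>K) - C)"
            using C by (simp add: component_def)
          moreover have "P - C \<subseteq> \<Union>K \<union> (S - (dominated {v} \<inter> S \<union> \<Union>K) - C)"
            by (auto simp: P_def)
          ultimately show ?thesis unfolding separated_def by blast
        qed
        hence "component C P" using CP by (auto simp: component_def)
        thus "\<not> triangle C" using CP by (auto simp: K_def)
      qed
      thus ?thesis
        using quarter_isolable_shared_triangles[OF fin v, of x H1 H2] link x
        unfolding K_def P_def by blast
    next
      case unique: False
      show ?thesis
      proof (cases "K = {}")
        case True
        have "quarter_isolable P"
          by (rule IH) (use True v in \<open>auto simp: K_def P\<close>)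
        moreover have "4 \<le> card (insert v (N v))"
          using False vN fin by (simp add: N_def)
        moreover have "insert v (N v) \<subseteq> dominated {v}" "insert v (N v) \<subseteq> S"
          using domv by auto
        ultimately show ?thesis
          using quarter_isolable_extend_dominated[OF fin _ _ _ v] unfolding P by blast
      next
        case Kne: False
        then obtain H where HK: "H \<in> K" by blast
        then obtain x y1 where x: "x \<in> S" "E v x" and y1: "y1 \<in> H" "E x y1"
          using link by blast
        have H: "H \<subseteq> P" "conn H" "separated H (P - H)" "card H = 3" "\<And>u w. u \<in> H \<Longrightarrow> w \<in> H \<Longrightarrow> u \<noteq> w \<Longrightarrow> E u w"
          using HK by (auto simp: K_def component_def triangle_def)
        have xH: "x \<notin> H" "v \<notin> H" using x H(1) by (auto simp: P N_def)
        have xv: "x \<noteq> v" using x E_irrefl by auto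
        have finH: "finite H" using H(4) card.infinite by fastforce
        define R where "R = S - insert x H"
        have vR: "v \<in> R" using v xH xv by (auto simp: R_def)
        have HS: "H \<subseteq> S" using H(1) by (auto simp: P)
        \<comment> \<open>A triangle component of \<open>R\<close> avoiding \<open>v\<close> avoids
          \<open>N v\<close> too, so it belongs to \<open>K\<close>, and the connectedness of
          \<open>S\<close> links it to \<open>x\<close>. Then \<open>x\<close> reaches two triangles
          of \<open>K\<close>, which \<open>unique\<close> forbids.\<close>
        have tri_v: "v \<in> C" if C: "component C R" "triangle C" for C
        proof (rule ccontr)
          assume vC: "v \<notin> C"
          have C': "C \<subseteq> R" "C \<noteq> {}" "conn C" "separated C (R - C)" using C by (auto simp: component_def)
          have "\<not> E v c" if "c \<in> C" for c
            using C'(4) vC vR E_sym[of v c] that by (auto simp: separated_def)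
          hence "C \<inter> N v = {}" by (auto simp: N_def)
          hence CP: "C \<subseteq> P - H" using C'(1) vC by (auto simp: P R_def)
          have CH: "separated C H" using separated_mono[OF separated_sym[OF H(3)], of C H] CP by auto
          have "separated C (P - C)"
            using CH C'(4) CP x by (auto simp: separated_def R_def P N_def)
          hence CK: "C \<in> K" using C C' CP by (auto simp: K_def component_def)
          have "C \<subseteq> S" "C \<noteq> S" using CP v by (auto simp: P)
          then obtain c d where cd: "c \<in> C" "d \<in> S - C" "E c d"
            using connE[OF con _ C'(2)] by blast
          have "d = x"
            using cd CH C'(4) by (auto simp: separated_def R_def)
          hence "E x c" using cd E_sym by blast
          moreover have "C \<noteq> H" using CP C'(2) by blast
          ultimately show False using unique x CK HK cd y1 by blast
        qed
        show ?thesis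
        proof (cases "\<exists>C. component C R \<and> triangle C")
          case no_tri: False
          have "quarter_isolable R"
            by (rule IH) (use no_tri x in \<open>auto simp: R_def\<close>)
          moreover have "insert x H \<subseteq> dominated {y1}"
            using y1(2) H(5)[OF y1(1)] E_sym by (auto simp: dominated_def)
          moreover have "4 \<le> card (insert x H)" using xH finH H(4) by simp
          moreover have "insert x H \<subseteq> S" "y1 \<in> S" using x(1) HS y1(1) by auto
          ultimately show ?thesis
            using quarter_isolable_extend_dominated[OF fin] unfolding R_def by blast
        next
          case True
          then obtain C where C: "component C R" "triangle C" by blast
          have vC: "v \<in> C" using tri_v C by blast
          have C': "C \<subseteq> R" "C \<noteq> {}" "conn C" "separated C (R - C)" "card C = 3"
            "\<And>u w. u \<in> C \<Longrightarrow> w \<in> C \<Longrightarrow> u \<noteq> w \<Longrightarrow> E u w"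
            using C by (auto simp: component_def triangle_def)
          have "card (C - {v}) = 2" using C'(5) vC by (simp add: card_Diff_singleton)
          then obtain a b where ab: "C - {v} = {a,b}" "a \<noteq> b" by (auto simp: card_2_iff)
          hence Ceq: "C = {v,a,b}" using vC by blast
          have "card (H - {y1}) = 2" using H(4) y1 by (simp add: card_Diff_singleton)
          then obtain y2 y3 where y23: "H - {y1} = {y2,y3}" "y2 \<noteq> y3" by (auto simp: card_2_iff)
          hence Heq: "H = {y1,y2,y3}" using y1 by blast
          have vH: "\<not> E v h" if "h \<in> H" for h using that H(1) by (auto simp: P N_def)
          \<comment> \<open>Neighbours of \<open>v\<close> inside \<open>R\<close> stay in its
            component \<open>C\<close>, and \<open>H\<close> contains none. As \<open>v\<close> has
            degree at least 3, the maximum degree is exactly 3.\<close>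
          have Nsub: "N v \<subseteq> {x,a,b}"
          proof
            fix w assume "w \<in> N v"
            hence w: "w \<in> S" "E v w" "w \<noteq> v" using vN by (auto simp: N_def)
            hence "w \<notin> R - C" using C'(4) vC by (auto simp: separated_def)
            moreover have "w \<notin> H" using vH w(2) by blast
            ultimately show "w \<in> {x,a,b}" using w by (auto simp: R_def Ceq)
          qed
          have "card {x,a,b} \<le> 3" by (simp add: card_insert_if)
          hence "card (N v) \<le> 3" using card_mono[OF _ Nsub] by simp
          hence deg: "card {w\<in>S. E u w} \<le> 3" if "u \<in> S" for u
            using vmax[OF that] by (simp add: N_def)
          have Nv: "N v = {x,a,b}"
            using card_seteq[OF _ Nsub] \<open>card {x,a,b} \<le> 3\<close> False by simp
          have seven: "card {v,a,b,x,y1,y2,y3} = 7"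
          proof -
            have "{v,a,b,x,y1,y2,y3} = C \<union> insert x H" by (auto simp: Ceq Heq)
            moreover have "C \<inter> insert x H = {}" using C'(1) by (auto simp: R_def)
            ultimately show ?thesis
              using card_Un_disjoint[of C "insert x H"] finH xH H(4) C'(5) by (simp add: Ceq)
          qed
          have RC: "S - {v,a,b,x,y1,y2,y3} = P - H" "R - C = P - H"
            by (auto simp: R_def P Nv Ceq Heq)
          \<comment> \<open>Components of \<open>R - C\<close> are components of \<open>R\<close>
            avoiding \<open>v\<close>, hence not triangles.\<close>
          have rest: "quarter_isolable (R - C)"
          proof (rule IH)
            show "R - C \<subset> S" using x by (auto simp: R_def)
            fix B assume B: "component B (R - C)"
            hence B': "B \<subseteq> R - C" "B \<noteq> {}" "conn B" "separated B (R - C - B)"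
              by (auto simp: component_def)
            have "separated B C"
              using separated_mono[OF separated_sym[OF C'(4)] B'(1)] by blast
            hence "separated B (R - B)" using B'(4) unfolding separated_def by blast
            hence "component B R" using B' by (auto simp: component_def)
            moreover have "v \<notin> B" using B vC by (auto simp: component_def)
            ultimately show "\<not> triangle B" using tri_v by blast
          qed
          have sep: "separated {v,a,b,y1,y2,y3} (P - H)"
          proof -
            have "separated C (P - H)" using C'(4) RC by simp
            thus ?thesis using H(3) by (auto simp: separated_def Ceq Heq)
          qed
          have "C \<subseteq> S" using C'(1) by (auto simp: R_def)
          hence sub: "{v,a,b,x,y1,y2,y3} \<subseteq> S" using HS x(1) by (auto simp: Ceq Heq)
          have "v \<noteq> a" "v \<noteq> b" "y1 \<noteq> y2" "y1 \<noteq> y3" using ab(1) y23(1) by auto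
          hence "E v a" "E v b" "E a b" "E y1 y2" "E y1 y3" "E y2 y3"
            using C'(6) H(5) ab(2) y23(2) by (simp_all add: Ceq Heq)
          thus ?thesis
            using quarter_isolable_two_triangles[OF fin sub seven deg] x(2) y1(2) sep rest
            unfolding RC by blast
        qed
      qed
    qed
  qed
qed

end

section \<open>Transfer to graphs and the upper bound\<close>

lemma adj_sym: "adj G u v \<Longrightarrow> adj G v u"
  by (simp add: adj_def insert_commute)

lemma adjD:
  assumes "simple_graph G" "adj G u v"
  shows "u \<in> verts G \<and> v \<in> verts G \<and> u \<noteq> v"
proof -
  obtain x y where "{u, v} = {x, y}" "x \<in> verts G" "y \<in> verts G" "x \<noteq> y"
    using assms unfolding simple_graph_def adj_def by blast
  thus ?thesis by (auto simp: doubleton_eq_iff)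
qed

lemma adj_complete_graph: "adj (complete_graph n) i j \<longleftrightarrow> i \<in> {1..n} \<and> j \<in> {1..n} \<and> i \<noteq> j"
  unfolding adj_def complete_graph_def by (auto simp: doubleton_eq_iff)

lemma finite_isolating_sets: "finite (verts G) \<Longrightarrow> finite {D. cycle_isolating G D}"
  by (rule finite_subset[of _ "Pow (verts G)"]) (auto simp: cycle_isolating_def)

lemma cycle_isolation_number_le:
  assumes "finite (verts G)" "cycle_isolating G D"
  shows "cycle_isolation_number G \<le> card D"
  unfolding cycle_isolation_number_def
  by (rule Min_le) (use assms(2) finite_isolating_sets[OF assms(1)] in auto)

lemma cycle_isolation_number_attained:
  assumes "simple_graph G"
  obtains D where "cycle_isolating G D" "cycle_isolation_number G = card D"
proof -
  have fin: "finite (verts G)" using assms by (simp add: simple_graph_def)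
  have "cycle_isolating G (verts G)"
  proof -
    have empty: "verts G - closed_nbhd_set G (verts G) = {}"
      by (auto simp: closed_nbhd_set_def closed_nbhd_def)
    show ?thesis
      unfolding cycle_isolating_def empty by (auto simp: is_cycle_def induced_subgraph_def)
  qed
  hence "cycle_isolation_number G \<in> {card D | D. cycle_isolating G D}"
    unfolding cycle_isolation_number_def
    by (intro Min_in) (use finite_isolating_sets[OF fin] in auto)
  thus ?thesis using that by auto
qed

text \<open>On a cycle each vertex is adjacent to its predecessor and its successor, so a cycle
  surviving outside \<open>dominated D\<close> would have a nonempty core as its vertex set.\<close>

theorem cycle_isolation_number_le_quarter:
  assumes G: "simple_graph G" "connected_graph G" "\<not> graph_iso G (complete_graph 3)"
  shows "4 * cycle_isolation_number G \<le> card (verts G)"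
proof -
  interpret sym_irrefl_rel "adj G"
  proof
    show "adj G v u" if "adj G u v" for u v using that by (rule adj_sym)
    show "\<not> adj G u u" for u using adjD[OF G(1), of u u] by blast
  qed
  have fin: "finite (verts G)" using G by (simp add: simple_graph_def)
  have "conn (verts G)"
    unfolding conn_def
  proof (intro allI impI, rule ccontr)
    fix C assume C: "C \<subseteq> verts G \<and> C \<noteq> {} \<and> separated C (verts G - C)" "C \<noteq> verts G"
    then obtain u w where uw: "u \<in> C" "w \<in> verts G - C" by blast
    have "(adj G)\<^sup>*\<^sup>* u w" using G(2) uw C by (auto simp: connected_graph_def)
    hence "w \<in> C"
    proof (induction rule: rtranclp_induct)
      case (step y z)
      have "z \<in> verts G" using adjD[OF G(1) step.hyps(2)] by blast
      thus ?case using C(1) step.hyps(2) step.IH unfolding separated_def by blast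
    qed (use uw in auto)
    thus False using uw by blast
  qed
  moreover have "\<not> triangle (verts G)"
  proof
    assume t: "triangle (verts G)"
    hence "card (verts G) = card {1..3::nat}" by (simp add: triangle_def)
    then obtain f where f: "bij_betw f (verts G) {1..3::nat}"
      using fin by (metis finite_same_card_bij finite_atLeastAtMost)
    have "adj G u w \<longleftrightarrow> adj (complete_graph 3) (f u) (f w)" if "u \<in> verts G" "w \<in> verts G" for u w
    proof -
      have "adj (complete_graph 3) (f u) (f w) \<longleftrightarrow> f u \<noteq> f w"
        using bij_betwE[OF f] that by (simp add: adj_complete_graph)
      also have "\<dots> \<longleftrightarrow> u \<noteq> w" using f that by (auto simp: bij_betw_def inj_on_def)
      also have "\<dots> \<longleftrightarrow> adj G u w"
        using t that adjD[OF G(1), of u w] unfolding triangle_def by blast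
      finally show ?thesis by simp
    qed
    hence "graph_iso G (complete_graph 3)"
      using f unfolding graph_iso_def by (auto simp: complete_graph_def)
    thus False using G by blast
  qed
  moreover have "verts G \<noteq> {}" using G(2) by (simp add: connected_graph_def)
  ultimately have "quarter_isolable (verts G)"
    using quarter_isolable_connected[OF fin] by blast
  then obtain D where D: "D \<subseteq> verts G" "core_free (verts G - dominated D)" "4 * card D \<le> card (verts G)"
    by (auto simp: quarter_isolable_def)
  \<comment> \<open>\<open>dominated\<close> does not mention the vertex set; it agrees with
    \<open>closed_nbhd_set\<close> because edges of a simple graph join vertices of
    \<open>G\<close>.\<close>
  have "closed_nbhd G d = insert d {w. adj G d w}" for d
    using adjD[OF G(1), of d] unfolding closed_nbhd_def by blast
  hence dom: "closed_nbhd_set G D = dominated D"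
    by (auto simp: closed_nbhd_set_def dominated_def)
  have "\<not> is_cycle (induced_subgraph G (verts G - closed_nbhd_set G D)) xs" for xs
  proof
    let ?n = "length xs"
    assume c: "is_cycle (induced_subgraph G (verts G - closed_nbhd_set G D)) xs"
    hence xs: "?n \<ge> 3" "distinct xs" "set xs \<subseteq> verts G - dominated D"
      and a: "\<And>i. i < ?n \<Longrightarrow> adj G (xs ! i) (xs ! (Suc i mod ?n))"
      by (auto simp: is_cycle_def induced_subgraph_def adj_def dom)
    have "core (set xs)"
      unfolding core_def
    proof
      fix t assume "t \<in> set xs"
      then obtain i where i: "i < ?n" "t = xs ! i" by (auto simp: in_set_conv_nth)
      \<comment> \<open>\<open>s\<close> and \<open>p\<close> are the cyclic successor and
        predecessor of position \<open>i\<close>; they differ because the length is at least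
        3.\<close>
      define s where "s = Suc i mod ?n"
      define p where "p = (if i = 0 then ?n - 1 else i - 1)"
      have p: "p < ?n" "Suc p mod ?n = i" using i xs(1) by (auto simp: p_def)
      have s: "s < ?n" using xs(1) by (auto simp: s_def intro!: mod_less_divisor)
      have "p \<noteq> s"
        using i xs(1) by (cases "Suc i = ?n") (auto simp: p_def s_def)
      hence "xs ! p \<noteq> xs ! s" using p s xs(2) by (simp add: nth_eq_iff_index_eq)
      moreover have "adj G t (xs ! s)" using a i by (simp add: s_def)
      moreover have "adj G t (xs ! p)" using a[OF p(1)] p i by (simp add: adj_sym)
      ultimately show "\<exists>u\<in>set xs. \<exists>w\<in>set xs. u \<noteq> w \<and> adj G t u \<and> adj G t w"
        using p s by (meson nth_mem)
    qed
    hence "set xs = {}" using core_freeD[OF D(2)] xs by blast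
    thus False using xs by auto
  qed
  hence "cycle_isolating G D" using D by (auto simp: cycle_isolating_def)
  thus ?thesis using cycle_isolation_number_le[OF fin] D by fastforce
qed

text \<open>\<open>Max\<close> is meaningful only on finite sets; the quarter bound itself confines
  the values to \<open>{..n}\<close>.\<close>

lemma finite_cycle_isolation_numbers:
  "finite {cycle_isolation_number G | G. simple_graph G \<and> verts G = {1..n::nat} \<and>
            connected_graph G \<and> \<not> graph_iso G (complete_graph 3)}" (is "finite ?M")
proof (rule finite_subset)
  show "?M \<subseteq> {..n}"
    using cycle_isolation_number_le_quarter by fastforce
qed auto

lemma not_graph_iso_complete_3:
  assumes "verts G = {1..n::nat}" "n \<ge> 4"
  shows "\<not> graph_iso G (complete_graph 3)"
proof
  assume "graph_iso G (complete_graph 3)"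
  then obtain f where "bij_betw f (verts G) (verts (complete_graph 3))"
    unfolding graph_iso_def by blast
  hence "card (verts G) = card {1..3::nat}"
    using bij_betw_same_card[of f "verts G"] by (simp add: complete_graph_def)
  thus False using assms by simp
qed

lemma max_cycle_isolation_number_le_quarter:
  assumes "n \<ge> 4"
  shows "4 * max_cycle_isolation_number n \<le> n"
proof -
  let ?M = "{cycle_isolation_number G | G. simple_graph G \<and> verts G = {1..n} \<and>
            connected_graph G \<and> \<not> graph_iso G (complete_graph 3)}"
  \<comment> \<open>The complete graph witnesses that \<open>?M\<close> is nonempty, so
    \<open>Max\<close> is attained; \<open>n \<ge> 4\<close> keeps it apart from the
    triangle.\<close>
  let ?K = "complete_graph n"
  have "simple_graph ?K" "verts ?K = {1..n}" by (auto simp: simple_graph_def complete_graph_def)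
  moreover have "connected_graph ?K"
    unfolding connected_graph_def
  proof (intro conjI ballI)
    fix u v assume uv: "u \<in> verts ?K" "v \<in> verts ?K"
    show "(adj ?K)\<^sup>*\<^sup>* u v"
    proof (cases "u = v")
      case False
      hence "adj ?K u v" using uv by (simp add: adj_complete_graph) (simp add: complete_graph_def)
      thus ?thesis by blast
    qed auto
  qed (use assms in \<open>auto simp: complete_graph_def\<close>)
  ultimately have "?M \<noteq> {}" using not_graph_iso_complete_3[of ?K n] assms by blast
  hence "max_cycle_isolation_number n \<in> ?M"
    unfolding max_cycle_isolation_number_def by (rule Max_in[OF finite_cycle_isolation_numbers])
  thus ?thesis using cycle_isolation_number_le_quarter by fastforce
qed

section \<open>Lower bound: linked cliques of size 4\<close>

text \<open>The vertices of \<open>block_graph k\<close> form \<open>k\<close> consecutive blocks of size 4. Each block is a clique,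
  and the first vertices of the blocks, congruent to 1 modulo 4, form a clique as well.\<close>

definition block_adj :: "nat \<Rightarrow> nat \<Rightarrow> bool" where
  "block_adj u v \<longleftrightarrow> u \<noteq> v \<and> ((u - 1) div 4 = (v - 1) div 4 \<or> (u mod 4 = 1 \<and> v mod 4 = 1))"

definition block_graph :: "nat \<Rightarrow> nat graph" where
  "block_graph k = ({1..4*k}, {{u, v} | u v. u \<in> {1..4*k} \<and> v \<in> {1..4*k} \<and> block_adj u v})"

lemma adj_block_graph:
  "adj (block_graph k) u v \<longleftrightarrow> u \<in> {1..4*k} \<and> v \<in> {1..4*k} \<and> block_adj u v"
  unfolding adj_def block_graph_def block_adj_def by (auto simp: doubleton_eq_iff)

text \<open>A walk goes from \<open>u\<close> to the first vertex of its block, then to the first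
  vertex of the block of \<open>v\<close>, then to \<open>v\<close>.\<close>

lemma connected_block_graph:
  assumes "k \<ge> 1"
  shows "connected_graph (block_graph k)"
  unfolding connected_graph_def
proof (intro conjI ballI)
  show "verts (block_graph k) \<noteq> {}" using assms by (auto simp: block_graph_def)
  \<comment> \<open>\<open>h u\<close> is the first vertex of the block of \<open>u\<close>;
    numbering starts at 1, whence the shift.\<close>
  define h :: "nat \<Rightarrow> nat" where "h u = 4 * ((u - 1) div 4) + 1" for u
  fix u v assume "u \<in> verts (block_graph k)" "v \<in> verts (block_graph k)"
  hence uv: "u \<in> {1..4*k}" "v \<in> {1..4*k}" by (auto simp: block_graph_def)
  have h: "h w \<in> {1..4*k}" "h w mod 4 = 1" "(h w - 1) div 4 = (w - 1) div 4" if "w \<in> {1..4*k}" for w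
  proof -
    have "4 * ((w - 1) div 4) \<le> w - 1" by simp
    thus "h w \<in> {1..4*k}" using that unfolding h_def by auto
    show "h w mod 4 = 1" unfolding h_def by presburger
  qed (simp add: h_def)
  have *: "(adj (block_graph k))\<^sup>*\<^sup>* w (h w)" "(adj (block_graph k))\<^sup>*\<^sup>* (h w) w" if "w \<in> {1..4*k}" for w
  proof -
    have "w = h w \<or> (adj (block_graph k) w (h w) \<and> adj (block_graph k) (h w) w)"
      using h[OF that] that by (auto simp: adj_block_graph block_adj_def)
    thus "(adj (block_graph k))\<^sup>*\<^sup>* w (h w)" "(adj (block_graph k))\<^sup>*\<^sup>* (h w) w" by auto
  qed
  have "h u = h v \<or> adj (block_graph k) (h u) (h v)"
    using h uv by (auto simp: adj_block_graph block_adj_def)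
  hence "(adj (block_graph k))\<^sup>*\<^sup>* (h u) (h v)" by auto
  thus "(adj (block_graph k))\<^sup>*\<^sup>* u v" using *[OF uv(1)] *[OF uv(2)] by (meson rtranclp_trans)
qed

text \<open>The last three vertices of a block have neighbours only within it. If \<open>D\<close>
  misses the block, their triangle survives; hence \<open>D\<close> maps onto the \<open>k\<close>
  block indices.\<close>

lemma cycle_isolating_block_graph_card:
  assumes D: "cycle_isolating (block_graph k) D"
  shows "k \<le> card D"
proof -
  have DV: "D \<subseteq> {1..4*k}" using D by (auto simp: cycle_isolating_def block_graph_def)
  hence fin: "finite D" using finite_subset by blast
  have "{..<k} \<subseteq> (\<lambda>d. (d - 1) div 4) ` D"
  proof (rule subsetI, rule ccontr)
    fix i assume i: "i \<in> {..<k}" "i \<notin> (\<lambda>d. (d - 1) div 4) ` D"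
    let ?W = "verts (block_graph k) - closed_nbhd_set (block_graph k) D"
    have W: "w \<in> ?W" if w: "w \<in> {4*i+2, 4*i+3, 4*i+4}" for w
    proof -
      have wV: "w \<in> {1..4*k}" and wb: "(w - 1) div 4 = i" and wm: "w mod 4 \<noteq> 1"
        using w i(1) by (auto; presburger)+
      have "w \<notin> closed_nbhd (block_graph k) d" if "d \<in> D" for d
      proof -
        have "(d - 1) div 4 \<noteq> i" using i(2) that by auto
        thus ?thesis using wb wm by (auto simp: closed_nbhd_def adj_block_graph block_adj_def)
      qed
      thus ?thesis using wV by (auto simp: closed_nbhd_set_def block_graph_def)
    qed
    let ?xs = "[4*i+2, 4*i+3, 4*i+4]"
    have A: "adj (induced_subgraph (block_graph k) ?W) u w"
      if "u \<in> set ?xs" "w \<in> set ?xs" "u \<noteq> w" for u w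
    proof -
      have "u \<in> ?W" "w \<in> ?W" using W that by auto
      moreover have "(u - 1) div 4 = (w - 1) div 4" using that by (auto; presburger)
      ultimately have "adj (block_graph k) u w" "u \<in> ?W" "w \<in> ?W"
        using that(3) unfolding adj_block_graph block_adj_def by (simp_all add: block_graph_def)
      thus ?thesis by (auto simp: adj_def induced_subgraph_def)
    qed
    have "is_cycle (induced_subgraph (block_graph k) ?W) ?xs"
      unfolding is_cycle_def
    proof (intro conjI allI impI)
      fix j assume "j < length ?xs"
      hence "j = 0 \<or> j = 1 \<or> j = 2" by auto
      thus "adj (induced_subgraph (block_graph k) ?W) (?xs ! j) (?xs ! (Suc j mod length ?xs))"
        using A by (elim disjE) (auto simp: numeral_2_eq_2)
    next
      show "set ?xs \<subseteq> verts (induced_subgraph (block_graph k) ?W)"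
        using W by (auto simp: induced_subgraph_def)
    qed auto
    thus False using D by (auto simp: cycle_isolating_def)
  qed
  thus ?thesis using surj_card_le[OF fin] by fastforce
qed

lemma max_cycle_isolation_number_ge:
  assumes "k \<ge> 1"
  shows "k \<le> max_cycle_isolation_number (4 * k)"
proof -
  have simple: "simple_graph (block_graph k)" and V: "verts (block_graph k) = {1..4*k}"
    unfolding simple_graph_def block_graph_def block_adj_def by auto
  obtain D where "cycle_isolating (block_graph k) D" "cycle_isolation_number (block_graph k) = card D"
    using cycle_isolation_number_attained[OF simple] .
  hence "k \<le> cycle_isolation_number (block_graph k)"
    using cycle_isolating_block_graph_card by simp
  also have "\<dots> \<le> max_cycle_isolation_number (4 * k)"
    unfolding max_cycle_isolation_number_def
  proof (rule Max_ge[OF finite_cycle_isolation_numbers])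
    have "\<not> graph_iso (block_graph k) (complete_graph 3)"
      using not_graph_iso_complete_3[OF V] assms by simp
    thus "cycle_isolation_number (block_graph k) \<in>
        {cycle_isolation_number G | G. simple_graph G \<and> verts G = {1..4 * k} \<and>
          connected_graph G \<and> \<not> graph_iso G (complete_graph 3)}"
      using simple V connected_block_graph[OF assms] by blast
  qed
  finally show ?thesis .
qed

section \<open>The limit superior\<close>

theorem corollary1p4:
  "limsup (\<lambda>n. ereal (real (max_cycle_isolation_number n) / real n)) = ereal (1 / 4)"
proof (rule antisym)
  let ?f = "\<lambda>n. ereal (real (max_cycle_isolation_number n) / real n)"
  show "limsup ?f \<le> ereal (1 / 4)"
  proof (rule Limsup_bounded)
    have "?f n \<le> ereal (1 / 4)" if "n \<ge> 4" for n
    proof -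
      have "4 * real (max_cycle_isolation_number n) \<le> real n"
        using max_cycle_isolation_number_le_quarter[OF that] by linarith
      thus ?thesis using that by (simp add: field_simps)
    qed
    thus "\<forall>\<^sub>F n in sequentially. ?f n \<le> ereal (1 / 4)"
      unfolding eventually_sequentially by blast
  qed
  \<comment> \<open>The lower bound is attained along the positive multiples of 4; the shift by one
    avoids \<open>n = 0\<close>.\<close>
  define r :: "nat \<Rightarrow> nat" where "r k = 4 * (k + 1)" for k
  have "ereal (1 / 4) \<le> limsup (?f \<circ> r)"
  proof (rule le_Limsup)
    have "ereal (1 / 4) \<le> (?f \<circ> r) k" for k
      using max_cycle_isolation_number_ge[of "k + 1"] by (simp add: r_def field_simps)
    thus "\<forall>\<^sub>F k in sequentially. ereal (1 / 4) \<le> (?f \<circ> r) k" by simp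
  qed simp
  also have "\<dots> \<le> limsup ?f"
    by (rule limsup_subseq_mono) (auto simp: strict_mono_def r_def)
  finally show "ereal (1 / 4) \<le> limsup ?f" .
qed

end
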